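(* Let $m\ge 2$ and $n\ge 1$ be integers and let $G$ be a non-abelian $\mathcal{T}(m,n)$-group containing at least $m$ pairwise non-commuting elements. Then $G$ is a finite group.
   Context: For integers $m\ge 2$ and $n\ge 1$, a group $G$ is called a $\mathcal{T}(m,n)$-group if for every $m$ subsets $X_1,\dots,X_m$ of $G$, each of cardinality $n$, there exist indices $i\ne j$ and elements $x_i\in X_i$, $x_j\in X_j$ such that $x_ix_j=x_jx_i$. Elements of a set are pairwise non-commuting if $xy\ne yx$ for any two distinct elements $x,y$ of the set. *)

theory Defs
  imports "HOL-Algebra.Group"
begin

definition commuting :: "('a, 'b) monoid_scheme \<Rightarrow> 'a \<Rightarrow> 'a \<Rightarrow> bool" where
  "commuting G x y \<longleftrightarrow> x \<otimes>\<^bsub>G\<^esub> y = y \<otimes>\<^bsub>G\<^esub> x"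

definition pairwise_noncommuting :: "('a, 'b) monoid_scheme \<Rightarrow> 'a set \<Rightarrow> bool" where
  "pairwise_noncommuting G A \<longleftrightarrow> A \<subseteq> carrier G \<and> pairwise (\<lambda>x y. \<not> commuting G x y) A"

(* The parameters are meant to satisfy m \<ge> 2 and n \<ge> 1; for n \<ge> 1 the condition
   card (X i) = n forces X i to be finite.  The X i need not be distinct: since
   n \<ge> 1, a repetition X i = X j satisfies the conclusion trivially. *)
definition T_group :: "nat \<Rightarrow> nat \<Rightarrow> ('a, 'b) monoid_scheme \<Rightarrow> bool" where
  "T_group m n G \<longleftrightarrow> group G \<and>
     (\<forall>X :: nat \<Rightarrow> 'a set.
        (\<forall>i\<in>{1..m}. X i \<subseteq> carrier G \<and> card (X i) = n) \<longrightarrow>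
        (\<exists>i\<in>{1..m}. \<exists>j\<in>{1..m}. i \<noteq> j \<and> (\<exists>x\<in>X i. \<exists>y\<in>X j. commuting G x y)))"

end

theory Submission
  imports Defs "HOL-Library.Ramsey"
begin

text \<open>
  If \<open>A\<close> is a maximal pairwise noncommuting set, then the centralizers of its elements cover \<open>G\<close>, and
  every \<open>a \<in> A\<close> lies in no other of them. The condition \<open>T(m, n)\<close> bounds the size of \<open>A\<close>. If \<open>G\<close> were infinite,
  then such an irredundant finite cover would have infinite intersection, and by Ramsey's theorem this
  intersection would contain an infinite set \<open>Y\<close> of commuting elements. But then subsets of the
  translates \<open>a Y\<close> with \<open>a \<in> A\<close> violate \<open>T(m, n)\<close>.
\<close>

definition common_centralizer :: "('a, 'b) monoid_scheme \<Rightarrow> 'a set \<Rightarrow> 'a set" where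
  "common_centralizer G S = {h \<in> carrier G. \<forall>s\<in>S. commuting G h s}"

lemma commuting_sym: "commuting G x y \<Longrightarrow> commuting G y x"
  by (simp add: commuting_def)

context group
begin

lemma commuting_mult:
  assumes "x \<in> carrier G" "y \<in> carrier G" "s \<in> carrier G" "commuting G x s" "commuting G y s"
  shows "commuting G (x \<otimes> y) s"
  using assms unfolding commuting_def by (metis m_assoc)

lemma commuting_inv:
  assumes "x \<in> carrier G" "s \<in> carrier G" "commuting G x s"
  shows "commuting G (inv x) s"
  using assms unfolding commuting_def by (metis inv_closed m_assoc r_inv l_inv l_one r_one m_closed)

lemma commuting_mult_cancel_left:
  assumes "h \<in> carrier G" "x \<in> carrier G" "s \<in> carrier G" "commuting G h s" "commuting G (h \<otimes> x) s"
  shows "commuting G x s"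
proof -
  have "commuting G (inv h \<otimes> (h \<otimes> x)) s"
    using assms by (intro commuting_mult[OF _ _ _ commuting_inv]) auto
  moreover have "inv h \<otimes> (h \<otimes> x) = x"
    using assms(1,2) by (simp add: m_assoc[symmetric])
  ultimately show ?thesis by simp
qed

text \<open>After rewriting \<open>a \<otimes> y\<close> as \<open>y \<otimes> a\<close> and
  \<open>b \<otimes> z\<close> as \<open>z \<otimes> b\<close>, the factor \<open>y\<close> cancels
  because it commutes with \<open>z \<otimes> b\<close>, and then \<open>z\<close> cancels because
  it commutes with \<open>a\<close>. So translates of noncommuting elements by such \<open>y\<close>
  and \<open>z\<close> still do not commute.\<close>

lemma mult_cross_commuting:
  assumes "a \<in> carrier G" "b \<in> carrier G" "y \<in> carrier G" "z \<in> carrier G"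
    and "commuting G y a" "commuting G y b" "commuting G z a" "commuting G z b" "commuting G y z"
    and "commuting G (a \<otimes> y) (b \<otimes> z)"
  shows "commuting G a b"
proof -
  have "a \<otimes> y = y \<otimes> a" "b \<otimes> z = z \<otimes> b"
    using assms(5,8) by (simp_all only: commuting_def)
  with assms(10) have comm: "commuting G (y \<otimes> a) (z \<otimes> b)"
    by simp
  have "commuting G y (z \<otimes> b)"
    using commuting_mult[of z b y] assms(2-4) assms(6,9)[THEN commuting_sym]
    by (blast intro: commuting_sym)
  then have "commuting G (z \<otimes> b) a"
    using commuting_mult_cancel_left[of y a "z \<otimes> b"] comm assms(1-4) by (blast intro: commuting_sym)
  then have "commuting G b a"
    using commuting_mult_cancel_left[of z b a] assms(1-4,7) by blast
  then show ?thesis by (rule commuting_sym)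
qed

text \<open>
  The coset \<open>M x\<close> of \<open>M = common_centralizer G S\<close> misses the centralizers of the elements of \<open>S\<close>, so the others
  cover it, and an infinite piece of the cover translates into an infinite intersection.
\<close>

lemma infinite_common_centralizer_step:
  assumes inf: "infinite (common_centralizer G S)"
    and A: "pairwise_noncommuting G A" "finite A" "S \<subseteq> A" "x \<in> A - S"
    and cover: "\<And>g. g \<in> carrier G \<Longrightarrow> \<exists>a\<in>A. commuting G g a"
  shows "\<exists>j \<in> A - S. infinite (common_centralizer G (insert j S))"
proof -
  let ?M = "common_centralizer G S"
  let ?P = "\<lambda>j. {h \<in> ?M. commuting G (h \<otimes> x) j}"
  have carr: "A \<subseteq> carrier G" and x: "x \<in> carrier G"
    using A by (auto simp: pairwise_noncommuting_def)
  have nc: "\<not> commuting G x s" if "s \<in> S" for s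
  proof -
    have "x \<in> A" "s \<in> A" "x \<noteq> s" using A(3,4) that by auto
    then show ?thesis using A(1) unfolding pairwise_noncommuting_def pairwise_def by blast
  qed
  have "?M \<subseteq> (\<Union>j\<in>A - S. ?P j)"
  proof
    fix h assume h: "h \<in> ?M"
    then have hc: "h \<in> carrier G" by (simp add: common_centralizer_def)
    obtain a where a: "a \<in> A" "commuting G (h \<otimes> x) a"
      using cover[OF m_closed[OF hc x]] by blast
    have "a \<notin> S"
    proof
      assume "a \<in> S"
      then have "commuting G x a"
        using h hc x a carr commuting_mult_cancel_left[of h x a]
        by (simp add: common_centralizer_def subset_eq)
      with nc \<open>a \<in> S\<close> show False by blast
    qed
    with a h show "h \<in> (\<Union>j\<in>A - S. ?P j)" by blast
  qed
  with inf have "infinite (\<Union>j\<in>A - S. ?P j)"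
    by (rule infinite_super[rotated])
  moreover have "finite (A - S)" using A(2) by simp
  ultimately obtain j where j: "j \<in> A - S" and infj: "infinite (?P j)"
    by (meson finite_UN_I)
  then obtain h0 where h0: "h0 \<in> ?P j"
    using infinite_imp_nonempty by blast
  \<comment> \<open>Both \<open>h \<otimes> x\<close> and \<open>h0 \<otimes> x\<close> commute with
    \<open>j\<close>, so their quotient does too; \<open>x\<close> cancels in it, leaving
    \<open>h \<otimes> inv h0\<close>, which also stays in \<open>?M\<close>.\<close>
  let ?f = "\<lambda>h. h \<otimes> inv h0"
  have h0c: "h0 \<in> carrier G" and jc: "j \<in> carrier G"
    using h0 j carr by (auto simp: common_centralizer_def)
  have "?f ` ?P j \<subseteq> common_centralizer G (insert j S)"
  proof (intro image_subsetI)
    fix h assume h: "h \<in> ?P j"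
    then have hc: "h \<in> carrier G" by (simp add: common_centralizer_def)
    have "commuting G ((h \<otimes> x) \<otimes> inv (h0 \<otimes> x)) j"
      using h h0 hc h0c x jc by (intro commuting_mult[OF _ _ _ _ commuting_inv]) auto
    moreover have "(h \<otimes> x) \<otimes> inv (h0 \<otimes> x) = h \<otimes> inv h0"
    proof -
      have "x \<otimes> (inv x \<otimes> inv h0) = inv h0"
        using h0c x by (simp add: m_assoc[symmetric])
      then show ?thesis
        using hc h0c x by (simp add: inv_mult_group m_assoc)
    qed
    moreover have "commuting G (h \<otimes> inv h0) s" if "s \<in> S" for s
      using that h h0 hc h0c carr A(3)
      by (intro commuting_mult commuting_inv) (auto simp: common_centralizer_def)
    ultimately show "?f h \<in> common_centralizer G (insert j S)"
      using hc h0c by (simp add: common_centralizer_def)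
  qed
  moreover have "inj_on ?f (?P j)"
    using h0c by (intro inj_onI) (auto simp: common_centralizer_def)
  ultimately have "infinite (common_centralizer G (insert j S))"
    using infj by (meson finite_imageD infinite_super)
  with j show ?thesis by blast
qed

text \<open>Starting from \<open>{}\<close>, whose common centralizer is the whole carrier, elements
  of \<open>A\<close> are added one at a time. The cover decides which element comes next, so the
  induction only claims some good subset of each size; at size \<open>card A\<close> it is
  \<open>A\<close>.\<close>

lemma infinite_common_centralizer:
  assumes inf: "infinite (carrier G)"
    and A: "pairwise_noncommuting G A" "finite A"
    and cover: "\<And>g. g \<in> carrier G \<Longrightarrow> \<exists>a\<in>A. commuting G g a"
  shows "infinite (common_centralizer G A)"
proof -
  have "\<exists>S \<subseteq> A. card S = k \<and> infinite (common_centralizer G S)" if "k \<le> card A" for k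
    using that
  proof (induction k)
    case 0
    then show ?case
      using inf by (intro exI[of _ "{}"]) (simp add: common_centralizer_def)
  next
    case (Suc k)
    then obtain S where S: "S \<subseteq> A" "card S = k" "infinite (common_centralizer G S)"
      by auto
    moreover from this Suc.prems have "S \<noteq> A" by auto
    ultimately obtain x where "x \<in> A - S" by blast
    then obtain j where j: "j \<in> A - S" "infinite (common_centralizer G (insert j S))"
      using infinite_common_centralizer_step[OF S(3) A S(1) _ cover] by blast
    then show ?case
      using S A(2) finite_subset[OF S(1) A(2)] by (intro exI[of _ "insert j S"]) auto
  qed
  from this[of "card A"] show ?thesis
    using A(2) card_subset_eq by blast
qed

end

text \<open>Otherwise \<open>m * n\<close> elements of \<open>A\<close> split into \<open>m\<close>
  disjoint blocks of size \<open>n\<close>, and \<T>-type commutation between two blocks would give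
  two distinct commuting elements of \<open>A\<close>.\<close>

lemma pairwise_noncommuting_card_less:
  assumes T: "T_group m n G" and A: "pairwise_noncommuting G A" "finite A"
  shows "card A < m * n"
proof (rule ccontr)
  assume "\<not> card A < m * n"
  then have "card {..<m * n} \<le> card A" by simp
  then obtain f where f: "f ` {..<m * n} \<subseteq> A" "inj_on f {..<m * n}"
    using card_le_inj[OF _ A(2)] by blast
  \<comment> \<open>The blocks are numbered from 1, as in \<open>T_group\<close>, so block
    \<open>i\<close> starts at \<open>(i - 1) * n\<close>.\<close>
  define B where "B i = {(i - 1) * n..<i * n}" for i :: nat
  have B: "B i \<subseteq> {..<m * n}" "card (B i) = n" if "i \<in> {1..m}" for i
  proof -
    have "i * n \<le> m * n" using that by simp
    then show "B i \<subseteq> {..<m * n}" unfolding B_def by (meson atLeastLessThan_iff lessThan_iff less_le_trans subsetI)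
    show "card (B i) = n" using that by (cases i) (auto simp: B_def)
  qed
  have disj: "p \<noteq> q" if "p \<in> B i" "q \<in> B j" "i \<noteq> j" for p q i j
  proof -
    have less: "p < q" if "p \<in> B i" "q \<in> B j" "i < j" for p q i j
    proof -
      have "p < i * n" "i * n \<le> (j - 1) * n" "(j - 1) * n \<le> q"
        using that by (auto simp: B_def)
      then show ?thesis by linarith
    qed
    show ?thesis
      using that less[of p i q j] less[of q j p i] by (cases i j rule: linorder_cases) auto
  qed
  have "\<forall>i\<in>{1..m}. f ` B i \<subseteq> carrier G \<and> card (f ` B i) = n"
  proof
    fix i assume "i \<in> {1..m}"
    note Bi = B[OF this]
    have "f ` B i \<subseteq> carrier G"
      using Bi(1) f(1) A(1) unfolding pairwise_noncommuting_def by blast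
    moreover have "card (f ` B i) = n"
      using Bi card_image[OF inj_on_subset[OF f(2) Bi(1)]] by simp
    ultimately show "f ` B i \<subseteq> carrier G \<and> card (f ` B i) = n" ..
  qed
  then have "\<exists>i\<in>{1..m}. \<exists>j\<in>{1..m}. i \<noteq> j \<and> (\<exists>x\<in>f ` B i. \<exists>y\<in>f ` B j. commuting G x y)"
    using T unfolding T_group_def by (elim conjE allE[of _ "\<lambda>i. f ` B i"]) blast
  then obtain i j p q where ij: "i \<in> {1..m}" "j \<in> {1..m}" "i \<noteq> j" "p \<in> B i" "q \<in> B j"
    "commuting G (f p) (f q)"
    by blast
  have pq: "p \<in> {..<m * n}" "q \<in> {..<m * n}" "p \<noteq> q"
    using ij B(1) disj by blast+
  then have "f p \<noteq> f q" "f p \<in> A" "f q \<in> A"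
    using f by (auto dest: inj_onD)
  then show False
    using A(1) ij(6) by (auto simp: pairwise_noncommuting_def pairwise_def)
qed

text \<open>Colour pairs by whether they commute. An infinite homogeneous set of the noncommuting
  colour would contain \<open>m * n\<close> pairwise noncommuting elements, which the cardinality
  bound forbids.\<close>

lemma infinite_commuting_subset:
  assumes T: "T_group m n G" and D: "D \<subseteq> carrier G" "infinite D"
  obtains Y where "Y \<subseteq> D" "infinite Y" "pairwise (commuting G) Y"
proof -
  \<comment> \<open>Colours live on unordered pairs; this is consistent because commuting is
    symmetric.\<close>
  define col where "col e = (if \<exists>x y. e = {x, y} \<and> commuting G x y then 0 else 1 :: nat)" for e
  have col: "col {x, y} = 0 \<longleftrightarrow> commuting G x y" for x y
    by (auto simp: col_def doubleton_eq_iff commuting_def)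
  have "\<forall>x\<in>D. \<forall>y\<in>D. x \<noteq> y \<longrightarrow> col {x, y} < 2"
    by (simp add: col_def)
  from Ramsey2[OF D(2) this] obtain Y t where Y: "Y \<subseteq> D" "infinite Y"
    and t: "\<forall>x\<in>Y. \<forall>y\<in>Y. x \<noteq> y \<longrightarrow> col {x, y} = t"
    by blast
  have "t = 0"
  proof (rule ccontr)
    assume "t \<noteq> 0"
    then have nc: "\<not> commuting G x y" if "x \<in> Y" "y \<in> Y" "x \<noteq> y" for x y
      using that t[rule_format, OF that] unfolding col[symmetric] by simp
    obtain A where A: "A \<subseteq> Y" "finite A" "card A = m * n"
      using infinite_arbitrarily_large[OF Y(2)] by blast
    then have "pairwise_noncommuting G A"
      using nc Y(1) D(1) unfolding pairwise_noncommuting_def pairwise_def by (meson order_trans subsetD)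
    with A show False
      using pairwise_noncommuting_card_less[OF T, of A] by simp
  qed
  then have "pairwise (commuting G) Y"
    using t col by (simp add: pairwise_def)
  with Y that show thesis by blast
qed

text \<open>The bound \<open>m * n\<close> yields a set of greatest cardinality, and an element
  commuting with none of its members could be added to it. The size comparison with \<open>A\<close>
  preserves the lower bound \<open>m\<close>.\<close>

lemma obtain_maximal_pairwise_noncommuting:
  assumes T: "T_group m n G" and A: "pairwise_noncommuting G A" "finite A"
  obtains M where "pairwise_noncommuting G M" "finite M" "card A \<le> card M"
    and "\<And>g. g \<in> carrier G \<Longrightarrow> \<exists>a\<in>M. commuting G g a"
proof -
  let ?P = "\<lambda>B. pairwise_noncommuting G B \<and> finite B"
  obtain M where M: "?P M" and max: "\<And>B. ?P B \<Longrightarrow> card B \<le> card M"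
    using ex_has_greatest_nat[of ?P A card "m * n"] pairwise_noncommuting_card_less[OF T] A
    by (metis less_imp_le)
  have "\<exists>a\<in>M. commuting G g a" if g: "g \<in> carrier G" for g
  proof (rule ccontr)
    assume *: "\<not> (\<exists>a\<in>M. commuting G g a)"
    then have "g \<notin> M" by (auto simp: commuting_def)
    moreover have "?P (insert g M)"
      using M * g by (auto simp: pairwise_noncommuting_def pairwise_insert dest: commuting_sym)
    ultimately show False
      using max[of "insert g M"] M by simp
  qed
  then show thesis
    using that M max[of A] A by blast
qed

theorem corollary2p14:
  fixes G :: "('a, 'b) monoid_scheme" and m n :: nat
  assumes "m \<ge> 2" and "n \<ge> 1"
    and "T_group m n G"
    and "\<not> comm_group G"
    and "\<exists>A. pairwise_noncommuting G A \<and> finite A \<and> card A \<ge> m"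
  shows "finite (carrier G)"
proof (rule ccontr)
  assume inf: "infinite (carrier G)"
  note T = assms(3)
  interpret group G using T by (simp add: T_group_def)
  obtain A where A: "pairwise_noncommuting G A" "finite A" "m \<le> card A"
    and cover: "\<And>g. g \<in> carrier G \<Longrightarrow> \<exists>a\<in>A. commuting G g a"
    using assms(5) obtain_maximal_pairwise_noncommuting[OF T] by (metis le_trans)
  let ?D = "common_centralizer G A"
  have "infinite ?D"
    by (rule infinite_common_centralizer[OF inf A(1,2) cover])
  moreover have "?D \<subseteq> carrier G"
    by (auto simp: common_centralizer_def)
  ultimately obtain Y where Y: "Y \<subseteq> ?D" "infinite Y" "pairwise (commuting G) Y"
    using infinite_commuting_subset[OF T] by blast
  then obtain Z where Z: "Z \<subseteq> Y" "finite Z" "card Z = n"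
    using infinite_arbitrarily_large by blast
  have ZD: "z \<in> carrier G" "a \<in> A \<Longrightarrow> commuting G z a" if "z \<in> Z" for z a
    using that Z(1) Y(1) by (auto simp: common_centralizer_def)
  \<comment> \<open>The case \<open>y = z\<close> matters: the same \<open>Z\<close> is used in
    every translate, while \<open>pairwise\<close> only speaks of distinct elements.\<close>
  have ZZ: "commuting G y z" if "y \<in> Z" "z \<in> Z" for y z
    using that Z(1) Y(3) by (cases "y = z") (auto simp: pairwise_def commuting_def)
  have "card {1..m} \<le> card A" using A(3) by simp
  then obtain f where f: "f ` {1..m} \<subseteq> A" "inj_on f {1..m}"
    using card_le_inj[OF _ A(2)] by blast
  then have fA: "f i \<in> A" "f i \<in> carrier G" if "i \<in> {1..m}" for i
    using that f(1) A(1) unfolding pairwise_noncommuting_def by blast+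
  \<comment> \<open>These are translates of one \<open>n\<close>-element set by \<open>m\<close>
    distinct members of \<open>A\<close>. A commuting pair from two of them reduces to commuting
    \<open>f i\<close> and \<open>f j\<close>, since the factors from \<open>Z\<close>
    cancel.\<close>
  let ?X = "\<lambda>i. (\<lambda>z. f i \<otimes>\<^bsub>G\<^esub> z) ` Z"
  have "\<forall>i\<in>{1..m}. ?X i \<subseteq> carrier G \<and> card (?X i) = n"
  proof
    fix i assume "i \<in> {1..m}"
    note fi = fA[OF this]
    have "inj_on (\<lambda>z. f i \<otimes>\<^bsub>G\<^esub> z) Z"
      using fi ZD(1) by (intro inj_onI) auto
    then show "?X i \<subseteq> carrier G \<and> card (?X i) = n"
      using fi ZD(1) Z(3) by (auto simp: card_image)
  qed
  then have "\<exists>i\<in>{1..m}. \<exists>j\<in>{1..m}. i \<noteq> j \<and> (\<exists>x\<in>?X i. \<exists>y\<in>?X j. commuting G x y)"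
    using T unfolding T_group_def by (elim conjE allE[of _ ?X]) blast
  then obtain i j y z where ij: "i \<in> {1..m}" "j \<in> {1..m}" "i \<noteq> j" and yz: "y \<in> Z" "z \<in> Z"
    and "commuting G (f i \<otimes>\<^bsub>G\<^esub> y) (f j \<otimes>\<^bsub>G\<^esub> z)"
    by blast
  then have "commuting G (f i) (f j)"
    using mult_cross_commuting[of "f i" "f j" y z] fA ZD ZZ by blast
  moreover have "f i \<noteq> f j"
    using f(2) ij by (auto dest: inj_onD)
  ultimately show False
    using A(1) fA(1) ij by (auto simp: pairwise_noncommuting_def pairwise_def)
qed

end
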